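(* Let $n$ be a positive integer and let $B_j$ denote the Bernoulli numbers. Then $$\frac{1}{(n+1)!}=\sum_{\substack{k_1+k_2+\cdots+k_n=p \\ k_1+2k_2+\cdots+nk_n=n}}\binom{p}{k_{1},\ldots,k_{n}}(-1)^{p}\left(\frac{B_{1}}{1!}\right)^{k_{1}}\left(\frac{B_{2}}{2!}\right)^{k_{2}}\cdots \left(\frac{B_{n}}{n!}\right)^{k_{n}}$$ and $$\frac{(-1)^{n}}{(n+1)!}=\det M,$$ where $M$ is the $n\times n$ matrix whose $(i,j)$ entry is $\frac{1}{(j-i+1)!}B_{j-i+1}$ if $j\ge i$, $1$ if $i=j+1$, and $0$ if $i>j+1$.
   Context: The Bernoulli numbers $B_n$ are defined by the formal power series identity $\left(1+\sum_{n\geq 1}\frac{1}{(n+1)!}X^{n}\right)^{-1}=1+\sum_{n\geq 1}\frac{1}{n!}B_{n}X^{n}$ (so $B_1=-\tfrac12$). The sum runs over all tuples of nonnegative integers $(k_1,\ldots,k_n)$ with $k_1+2k_2+\cdots+nk_n=n$, where $p=k_1+\cdots+k_n$, and $\binom{p}{k_1,\ldots,k_n}=\frac{p!}{k_1!\cdots k_n!}$. *)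

theory Defs
  imports
    "HOL-Computational_Algebra.Formal_Power_Series"
    "HOL-Library.FuncSet"
    "Jordan_Normal_Form.Determinant"
begin

definition bernoulli :: "nat \<Rightarrow> rat" where
  "bernoulli n =
     fact n * fps_nth (inverse (1 + Abs_fps (\<lambda>m. if m = 0 then 0 else 1 / fact (m + 1)))) n"

lemma bernoulli_fps:
  "inverse (1 + Abs_fps (\<lambda>n. if n = 0 then 0 else 1 / fact (n + 1))) =
     1 + Abs_fps (\<lambda>n. if n = 0 then 0 else bernoulli n / fact n)"
  by (rule fps_ext) (auto simp: bernoulli_def)

lemma bernoulli_1: "bernoulli 1 = - 1 / 2"
  by (simp add: bernoulli_def fps_inverse_def)

(* Tuples (k_1, ..., k_n) of naturals are extensional functions on {1..n}, so that distinct
   functions represent distinct tuples. *)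
definition weighted_tuples :: "nat \<Rightarrow> (nat \<Rightarrow> nat) set" where
  "weighted_tuples n = {k \<in> {1..n} \<rightarrow>\<^sub>E UNIV. (\<Sum>i = 1..n. i * k i) = n}"

lemma finite_weighted_tuples: "finite (weighted_tuples n)"
proof (rule finite_subset)
  show "weighted_tuples n \<subseteq> {1..n} \<rightarrow>\<^sub>E {0..n}"
  proof
    fix k assume k: "k \<in> weighted_tuples n"
    have "k i \<le> n" if i: "i \<in> {1..n}" for i
    proof -
      have "k i \<le> i * k i" using i by simp
      also have "\<dots> \<le> (\<Sum>i = 1..n. i * k i)"
        by (rule member_le_sum[OF i]) auto
      finally show ?thesis using k by (simp add: weighted_tuples_def)
    qed
    with k show "k \<in> {1..n} \<rightarrow>\<^sub>E {0..n}" by (auto simp: weighted_tuples_def PiE_iff)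
  qed
  show "finite ({1..n} \<rightarrow>\<^sub>E {0..n})" by (intro finite_PiE) auto
qed

definition multinomial :: "nat \<Rightarrow> (nat \<Rightarrow> nat) \<Rightarrow> rat" where
  "multinomial n k = fact (\<Sum>i = 1..n. k i) / (\<Prod>i = 1..n. fact (k i))"

(* Rows and columns are numbered from 0 here; every condition and entry depends only on the
   difference j - i, so the shift from 1-based indices changes nothing. *)
definition bernoulli_mat :: "nat \<Rightarrow> rat mat" where
  "bernoulli_mat n = mat n n (\<lambda>(i, j).
     if i \<le> j then bernoulli (j - i + 1) / fact (j - i + 1)
     else if i = j + 1 then 1
     else 0)"

end

theory Submission
  imports Defs
begin

text \<open>
  Both formulas invert a power series, and neither uses anything about Bernoulli numbers beyond the
  identity \<open>F * G = 1\<close> between their exponential generating function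
  \<open>F = 1 + a\<^sub>1 X + a\<^sub>2 X\<^sup>2 + \<dots>\<close>, where \<open>a\<^sub>i = B\<^sub>i / i!\<close>, and the series \<open>G\<close> with
  coefficients \<open>1 / (m + 1)!\<close>. Each formula computes the coefficients of \<open>G\<close> from those of \<open>F\<close>.

  For the sum over tuples, comparing coefficients in \<open>F * G = 1\<close> shows that the coefficients
  \<open>g\<^sub>m\<close> of \<open>G\<close> satisfy \<open>g\<^sub>m = \<Sum>\<^sub>i (- a\<^sub>i) g\<^sub>m\<^sub>-\<^sub>i\<close>. The multinomial sum of weight \<open>m\<close> satisfies the
  same recurrence (\<open>sum_multinomial_term_recurrence\<close>): a multinomial coefficient counts the
  arrangements of a multiset of parts, and splitting them by their first part \<open>i\<close> leaves an
  arrangement of weight \<open>m - i\<close>.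

  For the determinant, sending a power series to the upper triangular Toeplitz matrix of its first
  coefficients is multiplicative, so the matrix of \<open>F\<close> has the matrix of \<open>G\<close> as its inverse. As the
  former has determinant 1, its inverse is its adjugate, whose top right entry is, up to sign, the
  minor obtained by deleting the first column and the last row. This minor is the determinant in
  the theorem (\<open>fps_reciprocal_nth_det\<close>).
\<close>

section \<open>Tuples of given weight\<close>

text \<open>
  The length \<open>N\<close> of a tuple and its weight \<open>m\<close> are separate parameters: removing a part lowers the
  weight but must keep the length, so that a recurrence in \<open>m\<close> can be stated.
\<close>
definition tuples_of_weight :: "nat \<Rightarrow> nat \<Rightarrow> (nat \<Rightarrow> nat) set" where
  "tuples_of_weight N m = {k \<in> {1..N} \<rightarrow>\<^sub>E UNIV. (\<Sum>i = 1..N. i * k i) = m}"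

lemma finite_tuples_of_weight: "finite (tuples_of_weight N m)"
proof (rule finite_subset)
  show "tuples_of_weight N m \<subseteq> {1..N} \<rightarrow>\<^sub>E {0..m}"
  proof
    fix k assume k: "k \<in> tuples_of_weight N m"
    have "k i \<le> m" if i: "i \<in> {1..N}" for i
    proof -
      have "k i \<le> i * k i" using i by simp
      also have "\<dots> \<le> (\<Sum>i = 1..N. i * k i)"
        by (rule member_le_sum[OF i]) auto
      finally show ?thesis using k by (simp add: tuples_of_weight_def)
    qed
    with k show "k \<in> {1..N} \<rightarrow>\<^sub>E {0..m}" by (auto simp: tuples_of_weight_def PiE_iff)
  qed
qed (intro finite_PiE; simp)

lemma tuples_of_weight_0: "tuples_of_weight N 0 = {\<lambda>i\<in>{1..N}. 0}"
  by (auto simp: tuples_of_weight_def PiE_iff extensional_def fun_eq_iff)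

lemma weight_fun_upd:
  fixes k :: "nat \<Rightarrow> nat"
  assumes "i \<in> {1..N}"
  shows "(\<Sum>j = 1..N. j * (k(i := c)) j) + i * k i = (\<Sum>j = 1..N. j * k j) + i * c"
proof -
  have "(\<Sum>j\<in>{1..N} - {i}. j * (k(i := c)) j) = (\<Sum>j\<in>{1..N} - {i}. j * k j)"
    by (rule sum.cong) auto
  then show ?thesis
    using sum.remove[OF _ assms, of "\<lambda>j. j * (k(i := c)) j"]
      sum.remove[OF _ assms, of "\<lambda>j. j * k j"] by simp
qed

section \<open>Recurrence for multinomial sums\<close>

definition multinomial_term :: "'i set \<Rightarrow> ('i \<Rightarrow> 'a::field_char_0) \<Rightarrow> ('i \<Rightarrow> nat) \<Rightarrow> 'a" where
  "multinomial_term I x k = fact (\<Sum>i\<in>I. k i) / (\<Prod>i\<in>I. fact (k i)) * (\<Prod>i\<in>I. x i ^ k i)"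

lemma multinomial_term_decrement:
  fixes x :: "'i \<Rightarrow> 'a::field_char_0"
  assumes "finite I" "i \<in> I" "k i > 0"
  shows "of_nat (k i) * multinomial_term I x k =
    of_nat (\<Sum>j\<in>I. k j) * (x i * multinomial_term I x (k(i := k i - 1)))"
proof -
  define k' where "k' = k(i := k i - 1)"
  obtain c where c: "k i = Suc c" using assms(3) by (cases "k i") auto
  have rest: "k' j = k j" if "j \<in> I - {i}" for j
    using that by (auto simp: k'_def)
  have k'i: "k' i = c" by (simp add: k'_def c)
  have sums: "(\<Sum>j\<in>I. k j) = Suc (\<Sum>j\<in>I. k' j)"
    using assms rest by (simp add: sum.remove[of I i] c k'i)
  have facts: "(\<Prod>j\<in>I. fact (k j) :: 'a) = of_nat (k i) * (\<Prod>j\<in>I. fact (k' j))"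
    using assms rest by (simp add: prod.remove[of I i] c k'i algebra_simps)
  have pows: "(\<Prod>j\<in>I. x j ^ k j) = x i * (\<Prod>j\<in>I. x j ^ k' j)"
    using assms rest by (simp add: prod.remove[of I i] c k'i)
  have "of_nat (k i) \<noteq> (0::'a)" using assms(3) by simp
  moreover have "(\<Prod>j\<in>I. fact (k' j) :: 'a) \<noteq> 0"
    using assms(1) by simp
  ultimately show ?thesis
    unfolding multinomial_term_def k'_def[symmetric] facts pows sums fact_Suc
    by (simp add: field_simps del: of_nat_Suc)
qed

text \<open>
  Pascal's rule for multinomial coefficients, with the monomial carried along. Summing the preceding
  identity over \<open>i\<close> turns its left-hand factors into \<open>\<Sum>i\<in>I. k i\<close>, which then cancels.
\<close>
lemma multinomial_term_recurrence:
  fixes x :: "'i \<Rightarrow> 'a::field_char_0"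
  assumes "finite I" "(\<Sum>i\<in>I. k i) > 0"
  shows "multinomial_term I x k =
    (\<Sum>i\<in>I. if k i > 0 then x i * multinomial_term I x (k(i := k i - 1)) else 0)"
proof -
  let ?p = "of_nat (\<Sum>i\<in>I. k i) :: 'a"
  have "?p * multinomial_term I x k = (\<Sum>i\<in>I. of_nat (k i) * multinomial_term I x k)"
    by (simp add: sum_distrib_right)
  also have "\<dots> = (\<Sum>i\<in>I. ?p * (if k i > 0 then x i * multinomial_term I x (k(i := k i - 1)) else 0))"
    using multinomial_term_decrement[OF assms(1)] by (intro sum.cong) auto
  also have "\<dots> = ?p * (\<Sum>i\<in>I. if k i > 0 then x i * multinomial_term I x (k(i := k i - 1)) else 0)"
    by (simp only: sum_distrib_left)
  finally show ?thesis
    using assms(2) by (simp only: mult_cancel_left of_nat_eq_0_iff) simp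
qed

text \<open>
  Removing one copy of the part \<open>i\<close> is a bijection from the tuples of weight \<open>m\<close> that contain \<open>i\<close>
  onto all tuples of weight \<open>m - i\<close>.
\<close>
lemma sum_decrement_component:
  assumes i: "i \<in> {1..N}" "i \<le> m"
  shows "(\<Sum>k | k \<in> tuples_of_weight N m \<and> k i > 0. f (k(i := k i - 1))) =
    (\<Sum>k\<in>tuples_of_weight N (m - i). f k)"
proof (rule sum.reindex_bij_witness[where i = "\<lambda>k. k(i := Suc (k i))" and j = "\<lambda>k. k(i := k i - 1)"])
  fix k assume k: "k \<in> {k \<in> tuples_of_weight N m. k i > 0}"
  then show "(k(i := k i - 1))(i := Suc ((k(i := k i - 1)) i)) = k" by auto
  from k obtain c where c: "k i = Suc c" by (cases "k i") auto
  show "k(i := k i - 1) \<in> tuples_of_weight N (m - i)"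
    using k i weight_fun_upd[OF i(1), of k "k i - 1"]
    by (auto simp: tuples_of_weight_def PiE_iff extensional_def c)
next
  fix k assume k: "k \<in> tuples_of_weight N (m - i)"
  then show "k(i := Suc (k i)) \<in> {k \<in> tuples_of_weight N m. k i > 0}"
    using i weight_fun_upd[OF i(1), of k "Suc (k i)"]
    by (auto simp: tuples_of_weight_def PiE_iff extensional_def)
qed auto

lemma no_large_component:
  assumes "k \<in> tuples_of_weight N m" "i \<in> {1..N}" "i > m"
  shows "k i = 0"
proof -
  have "i * k i \<le> (\<Sum>j = 1..N. j * k j)"
    by (rule member_le_sum[OF assms(2)]) auto
  with assms(1) have "i * k i \<le> m" by (simp add: tuples_of_weight_def)
  with assms(3) show ?thesis by (cases "k i") auto
qed

text \<open>
  Pascal's rule is applied to each tuple, and the two sums are exchanged; for fixed \<open>i\<close>, the tuples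
  that contain the part \<open>i\<close> are then reindexed by what remains once one copy of it is removed.
\<close>
lemma sum_multinomial_term_recurrence:
  assumes m: "0 < m" "m \<le> N"
  shows "(\<Sum>k\<in>tuples_of_weight N m. multinomial_term {1..N} x k) =
    (\<Sum>i = 1..m. x i * (\<Sum>k\<in>tuples_of_weight N (m - i). multinomial_term {1..N} x k))"
proof -
  let ?T = "multinomial_term {1..N} x"
  let ?U = "\<lambda>i k. if k i > 0 then x i * ?T (k(i := k i - 1)) else 0"
  have "?T k = (\<Sum>i\<in>{1..N}. ?U i k)" if k: "k \<in> tuples_of_weight N m" for k
  proof (rule multinomial_term_recurrence)
    show "0 < (\<Sum>i = 1..N. k i)"
    proof (rule ccontr)
      assume "\<not> ?thesis"
      then have "(\<Sum>i = 1..N. i * k i) = 0" by simp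
      with k m show False by (simp add: tuples_of_weight_def)
    qed
  qed simp
  then have "sum ?T (tuples_of_weight N m) = (\<Sum>k\<in>tuples_of_weight N m. \<Sum>i\<in>{1..N}. ?U i k)"
    by (rule sum.cong[OF refl])
  also have "\<dots> = (\<Sum>i\<in>{1..N}. \<Sum>k\<in>tuples_of_weight N m. ?U i k)"
    by (rule sum.swap)
  also have "\<dots> = (\<Sum>i = 1..m. \<Sum>k\<in>tuples_of_weight N m. ?U i k)"
  proof (rule sum.mono_neutral_right)
    show "\<forall>i\<in>{1..N} - {1..m}. (\<Sum>k\<in>tuples_of_weight N m. ?U i k) = 0"
    proof (intro ballI sum.neutral)
      fix i k assume "i \<in> {1..N} - {1..m}" "k \<in> tuples_of_weight N m"
      then have "k i = 0" by (intro no_large_component[of k N m i]) auto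
      then show "?U i k = 0" by simp
    qed
  qed (use m in auto)
  also have "\<dots> = (\<Sum>i = 1..m. x i * sum ?T (tuples_of_weight N (m - i)))"
  proof (rule sum.cong[OF refl])
    fix i assume i: "i \<in> {1..m}"
    have "(\<Sum>k\<in>tuples_of_weight N m. ?U i k) =
        (\<Sum>k | k \<in> tuples_of_weight N m \<and> k i > 0. x i * ?T (k(i := k i - 1)))"
      by (rule sum.inter_filter[symmetric]) (rule finite_tuples_of_weight)
    also have "\<dots> = x i * sum ?T (tuples_of_weight N (m - i))"
      using i m unfolding sum_distrib_left[symmetric]
      by (subst sum_decrement_component[of i N m ?T]) auto
    finally show "(\<Sum>k\<in>tuples_of_weight N m. ?U i k) = x i * sum ?T (tuples_of_weight N (m - i))" .
  qed
  finally show ?thesis .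
qed

text \<open>
  Since \<open>F\<close> has constant term 1, the coefficient of \<open>X\<^sup>m\<close> in \<open>F * G = 1\<close> can be solved for that of
  \<open>G\<close>, which gives the recurrence of the multinomial sums; both start at 1.
\<close>
lemma fps_reciprocal_nth_multinomial:
  fixes F G :: "'a::field_char_0 fps"
  assumes inv: "F * G = 1" and F0: "fps_nth F 0 = 1" and "m \<le> N"
  shows "fps_nth G m =
    (\<Sum>k\<in>tuples_of_weight N m. multinomial_term {1..N} (\<lambda>i. - fps_nth F i) k)"
  using \<open>m \<le> N\<close>
proof (induction m rule: less_induct)
  case (less m)
  let ?S = "\<lambda>m. \<Sum>k\<in>tuples_of_weight N m. multinomial_term {1..N} (\<lambda>i. - fps_nth F i) k"
  show ?case
  proof (cases "m = 0")
    case True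
    have "fps_nth (F * G) 0 = 1" by (simp only: inv fps_one_nth) simp
    with True F0 show ?thesis
      by (simp add: tuples_of_weight_0 multinomial_term_def)
  next
    case False
    have "0 = fps_nth (F * G) m" using False by (simp add: inv)
    also have "\<dots> = (\<Sum>i = 0..m. fps_nth F i * fps_nth G (m - i))"
      by (rule fps_mult_nth)
    also have "\<dots> = fps_nth G m + (\<Sum>i = 1..m. fps_nth F i * fps_nth G (m - i))"
      by (simp add: sum.atLeast_Suc_atMost F0)
    finally have "fps_nth G m = (\<Sum>i = 1..m. - fps_nth F i * fps_nth G (m - i))"
      by (simp add: sum_negf eq_neg_iff_add_eq_0)
    also have "\<dots> = (\<Sum>i = 1..m. - fps_nth F i * ?S (m - i))"
      using less by (intro sum.cong) auto
    also have "\<dots> = ?S m"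
      using False less.prems by (intro sum_multinomial_term_recurrence[symmetric]) auto
    finally show ?thesis .
  qed
qed

section \<open>Toeplitz matrices and the determinant\<close>

definition toeplitz_mat :: "nat \<Rightarrow> 'a::comm_ring_1 fps \<Rightarrow> 'a mat" where
  "toeplitz_mat n F = mat n n (\<lambda>(i, j). if i \<le> j then fps_nth F (j - i) else 0)"

lemma toeplitz_mat_carrier [simp]: "toeplitz_mat n F \<in> carrier_mat n n"
  by (simp add: toeplitz_mat_def)

lemma toeplitz_mat_one: "toeplitz_mat n 1 = 1\<^sub>m n"
  by (rule eq_matI) (auto simp: toeplitz_mat_def)

text \<open>
  An entry of the product only receives terms with \<open>i \<le> l \<le> j\<close>, and these form the Cauchy
  product at index \<open>j - i\<close>.
\<close>
lemma toeplitz_mat_mult: "toeplitz_mat n F * toeplitz_mat n G = toeplitz_mat n (F * G)"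
proof (rule eq_matI)
  fix i j assume "i < dim_row (toeplitz_mat n (F * G))" "j < dim_col (toeplitz_mat n (F * G))"
  then have ij: "i < n" "j < n" by (auto simp: toeplitz_mat_def)
  let ?g = "\<lambda>l. fps_nth F (l - i) * fps_nth G (j - l)"
  have "(toeplitz_mat n F * toeplitz_mat n G) $$ (i, j) =
      (\<Sum>l = 0..<n. (if i \<le> l then fps_nth F (l - i) else 0) * (if l \<le> j then fps_nth G (j - l) else 0))"
    using ij by (simp add: toeplitz_mat_def scalar_prod_def)
  also have "\<dots> = (\<Sum>l\<in>{i..j}. ?g l)"
    using ij by (intro sum.mono_neutral_cong_right) auto
  also have "\<dots> = (if i \<le> j then fps_nth (F * G) (j - i) else 0)"
  proof (cases "i \<le> j")
    case True
    have "(\<Sum>l\<in>{i..j}. ?g l) = (\<Sum>l = 0..j - i. fps_nth F l * fps_nth G (j - i - l))"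
      by (rule sum.reindex_bij_witness[where i = "\<lambda>l. l + i" and j = "\<lambda>l. l - i"])
        (use True in auto)
    with True show ?thesis by (simp add: fps_mult_nth)
  qed simp
  finally show "(toeplitz_mat n F * toeplitz_mat n G) $$ (i, j) = toeplitz_mat n (F * G) $$ (i, j)"
    using ij by (simp add: toeplitz_mat_def)
qed (auto simp: toeplitz_mat_def)

lemma det_toeplitz_mat: "det (toeplitz_mat n F) = fps_nth F 0 ^ n"
proof -
  have "upper_triangular (toeplitz_mat n F)" by (auto simp: toeplitz_mat_def)
  from det_upper_triangular[OF this toeplitz_mat_carrier]
  have "det (toeplitz_mat n F) = prod_list (diag_mat (toeplitz_mat n F))" .
  also have "diag_mat (toeplitz_mat n F) = replicate n (fps_nth F 0)"
    by (rule nth_equalityI) (auto simp: diag_mat_def toeplitz_mat_def)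
  finally show ?thesis by simp
qed

lemma adj_mat_eq_inverse:
  fixes A B :: "'a::comm_ring_1 mat"
  assumes A: "A \<in> carrier_mat n n" and B: "B \<in> carrier_mat n n"
    and inv: "A * B = 1\<^sub>m n" and det: "det A = 1"
  shows "adj_mat A = B"
proof -
  note adj = adj_mat[OF A]
  have smult_one: "1 \<cdot>\<^sub>m 1\<^sub>m n = (1\<^sub>m n :: 'a mat)"
    by (rule eq_matI) auto
  have "adj_mat A = adj_mat A * (A * B)" unfolding inv using adj(1) by simp
  also have "\<dots> = adj_mat A * A * B" using A B adj by (intro assoc_mult_mat[symmetric])
  also have "\<dots> = B" unfolding adj(3) det using B by (simp add: smult_one)
  finally show ?thesis .
qed

text \<open>
  The adjugate of the Toeplitz matrix of \<open>F\<close> of size \<open>n + 1\<close> is the Toeplitz matrix of \<open>G\<close>; the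
  formula compares their entries at \<open>(0, n)\<close>. Deleting column 0 shifts the diagonals by one, which
  moves the constant term 1 of \<open>F\<close> to the subdiagonal.
\<close>
lemma fps_reciprocal_nth_det:
  fixes F G :: "'a::comm_ring_1 fps"
  assumes inv: "F * G = 1" and F0: "fps_nth F 0 = 1"
  shows "fps_nth G n = (-1) ^ n *
    det (mat n n (\<lambda>(i, j). if i \<le> j + 1 then fps_nth F (j + 1 - i) else 0))"
proof -
  let ?L = "toeplitz_mat (Suc n) F"
  have "adj_mat ?L = toeplitz_mat (Suc n) G"
    by (rule adj_mat_eq_inverse[OF toeplitz_mat_carrier toeplitz_mat_carrier])
      (simp_all add: toeplitz_mat_mult inv toeplitz_mat_one det_toeplitz_mat F0)
  then have "adj_mat ?L $$ (0, n) = fps_nth G n"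
    by (simp add: toeplitz_mat_def)
  then have "fps_nth G n = cofactor ?L n 0"
    by (simp add: adj_mat_def toeplitz_mat_def)
  also have "\<dots> = (-1) ^ n * det (mat_delete ?L n 0)"
    by (simp add: cofactor_def)
  also have "mat_delete ?L n 0 = mat n n (\<lambda>(i, j). if i \<le> j + 1 then fps_nth F (j + 1 - i) else 0)"
    by (rule eq_matI) (auto simp: mat_delete_def toeplitz_mat_def)
  finally show ?thesis .
qed

section \<open>Bernoulli numbers\<close>

definition bernoulli_egf :: "rat fps" where
  "bernoulli_egf = Abs_fps (\<lambda>i. bernoulli i / fact i)"

lemma bernoulli_egf_reciprocal: "bernoulli_egf * Abs_fps (\<lambda>i. 1 / fact (i + 1)) = 1"
proof -
  have "Abs_fps (\<lambda>i. 1 / fact (i + 1) :: rat) = 1 + Abs_fps (\<lambda>m. if m = 0 then 0 else 1 / fact (m + 1))"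
    (is "?G = ?H")
    by (rule fps_ext) simp
  moreover have "bernoulli_egf = inverse ?H"
    by (rule fps_ext) (simp add: bernoulli_egf_def bernoulli_def)
  moreover have "inverse ?H * ?H = 1"
    by (rule inverse_mult_eq_1) simp
  ultimately show ?thesis by simp
qed

lemma bernoulli_0: "bernoulli 0 = 1"
  by (simp add: bernoulli_def)

theorem theorem2p2:
  fixes n :: nat
  assumes "n \<ge> 1"
  shows "1 / fact (n + 1) =
           (\<Sum>k\<in>weighted_tuples n. multinomial n k * (-1) ^ (\<Sum>i = 1..n. k i) *
              (\<Prod>i = 1..n. (bernoulli i / fact i) ^ k i)) \<and>
         (-1) ^ n / fact (n + 1) = det (bernoulli_mat n)"
proof
  have B0: "fps_nth bernoulli_egf 0 = 1" by (simp add: bernoulli_egf_def bernoulli_0)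
  have T: "multinomial_term {1..n} (\<lambda>i. - fps_nth bernoulli_egf i) k =
      multinomial n k * (-1) ^ (\<Sum>i = 1..n. k i) * (\<Prod>i = 1..n. (bernoulli i / fact i) ^ k i)" for k
  proof -
    have "(\<Prod>i = 1..n. (- (bernoulli i / fact i)) ^ k i) =
        (-1) ^ (\<Sum>i = 1..n. k i) * (\<Prod>i = 1..n. (bernoulli i / fact i) ^ k i)"
      unfolding power_sum prod.distrib[symmetric] power_mult_distrib[symmetric] by simp
    then show ?thesis
      by (simp only: multinomial_term_def multinomial_def bernoulli_egf_def fps_nth_Abs_fps mult.assoc)
  qed
  have W: "weighted_tuples n = tuples_of_weight n n"
    by (simp add: weighted_tuples_def tuples_of_weight_def)
  show "1 / fact (n + 1) =
      (\<Sum>k\<in>weighted_tuples n. multinomial n k * (-1) ^ (\<Sum>i = 1..n. k i) *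
        (\<Prod>i = 1..n. (bernoulli i / fact i) ^ k i))"
    using fps_reciprocal_nth_multinomial[OF bernoulli_egf_reciprocal B0 order_refl, of n]
    by (simp only: W T fps_nth_Abs_fps)
  have "mat n n (\<lambda>(i, j). if i \<le> j + 1 then fps_nth bernoulli_egf (j + 1 - i) else 0) = bernoulli_mat n"
    by (rule eq_matI) (auto simp: bernoulli_mat_def bernoulli_egf_def bernoulli_0 le_Suc_eq Suc_diff_le)
  with fps_reciprocal_nth_det[OF bernoulli_egf_reciprocal B0, of n]
  have "1 / fact (n + 1) = (-1) ^ n * det (bernoulli_mat n)"
    by (simp only: fps_nth_Abs_fps)
  then have "(-1) ^ n * (1 / fact (n + 1)) = ((-1) ^ n * (-1) ^ n) * det (bernoulli_mat n)"
    by (simp only: mult.assoc)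
  then show "(-1) ^ n / fact (n + 1) = det (bernoulli_mat n)"
    by (simp add: power_mult_distrib[symmetric])
qed

end
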